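(* Let $G$ be a finite group of order $m$ and let $n$ be a positive integer. For non-negative integers $s,t$ let $$c_{n,t}(s)=\sum_{k\ge 0}w_m(n,k)\,W_m(k+s,t)$$ denote the shifted convolution of the Whitney numbers of the Dowling lattices of $G$. Then $c_{n,t}(s)=0$ if $t<n$. If $t\ge n$, then $$\sum_{s\ge 0}c_{n,t}(s)\,x^s=\frac1x\prod_{j=n}^{t}\frac{x}{1-(1+jm)x}.$$ In particular, $$\sum_{k\ge 0}w_m(n,k)\,W_m(k,t)=\delta(n,t),$$ where $\delta(n,t)=1$ if $n=t$ and $\delta(n,t)=0$ otherwise.
   Context: Dowling lattice $Q_n(G)$. Let $n\ge 0$, let $X=\{x_1,\dots,x_n\}$ be a set of $n$ elements, and let $G$ be a finite multiplicative group of order $m$. A partial partition of $X$ is a collection $\{A_1,\dots,A_r\}$ (possibly empty) of mutually disjoint non-empty subsets of $X$, called its blocks. A partial $G$-partition of $X$ is a collection $\mathcal{F}=\{\alpha_1,\dots,\alpha_r\}$ of functions $\alpha_i:A_i\to G$ where $\{A_1,\dots,A_r\}$ is a partial partition of $X$; write $|\mathcal{F}|=r$. Given $\mathcal{F}=\{\alpha_i:A_i\to G\}_{i=1}^{r}$ and $\mathcal{G}=\{\beta_j:B_j\to G\}_{j=1}^{s}$, write $\mathcal{F}\le\mathcal{G}$ if every $B_j$ is a union $\bigcup_{i\in M_j}A_i$ of blocks $A_i$ and for each $j$ and each $i\in M_j$ there is $\lambda_i\in G$ with $\beta_j|_{A_i}=\lambda_i\alpha_i$ (i.e. $\beta_j(x)=\lambda_i\alpha_i(x)$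 for $x\in A_i$). This is a preorder; $Q_n(G)$ is the quotient of the set of partial $G$-partitions by the equivalence relation $\mathcal{F}\sim\mathcal{G}\iff\mathcal{F}\le\mathcal{G}$ and $\mathcal{G}\le\mathcal{F}$, with the induced partial order. $Q_n(G)$ is a geometric lattice (Dowling), of rank $n$, with rank function $r(\mathcal{F})=n-|\mathcal{F}|$; its least element $\hat 0$ is the class of $\{e_1,\dots,e_n\}$, where $e_i:\{x_i\}\to G$, $e_i(x_i)=1$. The Möbius function $\mu$ of a finite poset is defined by $\mu(x,z)=0$ if $x\not\le z$, $\mu(x,x)=1$, and $\mu(x,z)=-\sum_{x\le y<z}\mu(x,y)$ if $x<z$. Whitney numbers of $Q_n(G)$ of the first and second kind: $$w_m(n,k)=\sum_{x\in Q_n(G),\ r(x)=n-k}\mu(\hat 0,x),\qquad W_m(n,k)=\sum_{x\in Q_n(G),\ r(x)=n-k}1 .$$ They are $0$ when $k>n$, so the sums over $k$ in the claim are finite. They depend on $G$ only through $m=|G|$. The generating function identity is an identity of formal power series in $x$ (after cancelling the factor $1/x$). *)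

theory Defs
  imports
    "HOL-Algebra.Coset"
    "HOL-Library.Groups_Big_Fun"
    "HOL-Computational_Algebra.Formal_Power_Series"
begin

section \<open>Moebius function of a finite poset\<close>

text \<open>
  The recursion runs along the strict order of the carrier. The resulting equations hold in every
  finite partial order, see \<open>mobius_outside\<close>, \<open>mobius_refl\<close> and \<open>mobius_less\<close> below.
\<close>

definition mobius :: "('a, 'b) gorder_scheme \<Rightarrow> 'a \<Rightarrow> 'a \<Rightarrow> int" where
  "mobius P x = wfrec {(y, z). y \<in> carrier P \<and> z \<in> carrier P \<and> y \<sqsubset>\<^bsub>P\<^esub> z}
     (\<lambda>f z. if \<not> x \<sqsubseteq>\<^bsub>P\<^esub> z then 0
            else if x = z then 1
            else - (\<Sum>y\<in>{y \<in> carrier P. x \<sqsubseteq>\<^bsub>P\<^esub> y \<and> y \<sqsubset>\<^bsub>P\<^esub> z}. f y))"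

lemma wf_strict_order:
  fixes P (structure)
  assumes "partial_order P" "finite (carrier P)"
  shows "wf {(y, z). y \<in> carrier P \<and> z \<in> carrier P \<and> y \<sqsubset> z}" (is "wf ?R")
proof -
  interpret partial_order P by fact
  have "finite ?R"
    by (rule finite_subset[OF _ finite_cartesian_product[OF assms(2) assms(2)]]) auto
  moreover have "trans ?R"
    by (auto intro!: transI intro: lless_trans)
  then have "acyclic ?R"
    by (auto simp: acyclic_def trancl_id lless_def eq_is_equal)
  ultimately show ?thesis
    by (rule finite_acyclic_wf)
qed

lemma mobius_rec:
  fixes P (structure)
  assumes "partial_order P" "finite (carrier P)" "z \<in> carrier P"
  shows "mobius P x z = (if \<not> x \<sqsubseteq> z then 0 else if x = z then 1
           else - (\<Sum>y\<in>{y \<in> carrier P. x \<sqsubseteq> y \<and> y \<sqsubset> z}. mobius P x y))"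
  unfolding mobius_def
  by (subst wfrec[OF wf_strict_order[OF assms(1,2)]])
    (auto simp: cut_apply assms intro!: sum.cong)

lemma mobius_outside:
  fixes P (structure)
  assumes "partial_order P" "finite (carrier P)" "z \<in> carrier P" "\<not> x \<sqsubseteq> z"
  shows "mobius P x z = 0"
  using assms by (subst mobius_rec) auto

lemma mobius_refl:
  fixes P (structure)
  assumes "partial_order P" "finite (carrier P)" "x \<in> carrier P"
  shows "mobius P x x = 1"
proof -
  interpret partial_order P by fact
  show ?thesis using assms by (subst mobius_rec) auto
qed

lemma mobius_less:
  fixes P (structure)
  assumes "partial_order P" "finite (carrier P)" "z \<in> carrier P" "x \<sqsubset> z"
  shows "mobius P x z = - (\<Sum>y\<in>{y \<in> carrier P. x \<sqsubseteq> y \<and> y \<sqsubset> z}. mobius P x y)"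
proof -
  interpret partial_order P by fact
  show ?thesis using assms by (subst mobius_rec) (auto simp: lless_def eq_is_equal)
qed


section \<open>Dowling lattices\<close>

text \<open>
  A function from a block to the group is a map whose domain is the block. Disjointness of the
  domains of different maps also excludes two different functions on the same block.
\<close>

definition partial_gpartitions :: "('g, 'b) monoid_scheme \<Rightarrow> 'a set \<Rightarrow> ('a \<rightharpoonup> 'g) set set" where
  "partial_gpartitions G X =
     {F. (\<forall>\<alpha>\<in>F. dom \<alpha> \<noteq> {} \<and> dom \<alpha> \<subseteq> X \<and> ran \<alpha> \<subseteq> carrier G)
       \<and> pairwise (\<lambda>\<alpha> \<beta>. disjnt (dom \<alpha>) (dom \<beta>)) F}"

definition dowling_le ::
    "('g, 'b) monoid_scheme \<Rightarrow> ('a \<rightharpoonup> 'g) set \<Rightarrow> ('a \<rightharpoonup> 'g) set \<Rightarrow> bool" where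
  "dowling_le G F H \<longleftrightarrow>
     (\<forall>\<beta>\<in>H. \<exists>M\<subseteq>F. dom \<beta> = (\<Union>\<alpha>\<in>M. dom \<alpha>)
        \<and> (\<forall>\<alpha>\<in>M. \<exists>c\<in>carrier G. \<forall>x\<in>dom \<alpha>. the (\<beta> x) = c \<otimes>\<^bsub>G\<^esub> the (\<alpha> x)))"

definition dowling_equiv ::
    "('g, 'b) monoid_scheme \<Rightarrow> 'a set \<Rightarrow> (('a \<rightharpoonup> 'g) set \<times> ('a \<rightharpoonup> 'g) set) set" where
  "dowling_equiv G X =
     {(F, H). F \<in> partial_gpartitions G X \<and> H \<in> partial_gpartitions G X
        \<and> dowling_le G F H \<and> dowling_le G H F}"

definition dowling_lattice ::
    "('g, 'b) monoid_scheme \<Rightarrow> 'a set \<Rightarrow> ('a \<rightharpoonup> 'g) set set gorder" where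
  "dowling_lattice G X =
     \<lparr>carrier = partial_gpartitions G X // dowling_equiv G X,
      eq = (=),
      le = (\<lambda>C D. \<exists>F\<in>C. \<exists>H\<in>D. dowling_le G F H)\<rparr>"

definition dowling_zero :: "('g, 'b) monoid_scheme \<Rightarrow> 'a set \<Rightarrow> ('a \<rightharpoonup> 'g) set set" where
  "dowling_zero G X = dowling_equiv G X `` {(\<lambda>x. [x \<mapsto> \<one>\<^bsub>G\<^esub>]) ` X}"

text \<open>
  All representatives of a class have the same number of blocks, so the image below is a
  singleton, see \<open>dowling_rank_eq\<close>.
\<close>

definition dowling_rank :: "'a set \<Rightarrow> ('a \<rightharpoonup> 'g) set set \<Rightarrow> int" where
  "dowling_rank X C = the_elem ((\<lambda>F. int (card X) - int (card F)) ` C)"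


section \<open>Whitney numbers\<close>

text \<open>
  The rank is an integer, so that for \<open>k > n\<close> the condition \<open>r(x) = n - k\<close> has no solution.
\<close>

definition whitney1 :: "('g, 'b) monoid_scheme \<Rightarrow> nat \<Rightarrow> nat \<Rightarrow> int" where
  "whitney1 G n k =
     (\<Sum>x\<in>{x \<in> carrier (dowling_lattice G {1..n}). dowling_rank {1..n} x = int n - int k}.
        mobius (dowling_lattice G {1..n}) (dowling_zero G {1..n}) x)"

definition whitney2 :: "('g, 'b) monoid_scheme \<Rightarrow> nat \<Rightarrow> nat \<Rightarrow> int" where
  "whitney2 G n k =
     (\<Sum>x\<in>{x \<in> carrier (dowling_lattice G {1..n}). dowling_rank {1..n} x = int n - int k}. 1)"

text \<open>
  Only finitely many summands are non-zero, see \<open>shifted_convolution_eq_sum\<close>.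
\<close>

definition shifted_convolution ::
    "('g, 'b) monoid_scheme \<Rightarrow> nat \<Rightarrow> nat \<Rightarrow> nat \<Rightarrow> int" where
  "shifted_convolution G n t s = Sum_any (\<lambda>k. whitney1 G n k * whitney2 G (k + s) t)"


section \<open>Well-definedness\<close>

lemma finite_partial_gpartitions:
  assumes "finite X" "finite (carrier G)"
  shows "finite (partial_gpartitions G X)"
proof -
  have "finite {\<alpha>. dom \<alpha> \<subseteq> X \<and> ran \<alpha> \<subseteq> carrier G}"
  proof -
    have "{\<alpha>. dom \<alpha> \<subseteq> X \<and> ran \<alpha> \<subseteq> carrier G}
        = (\<Union>A\<in>Pow X. {\<alpha>. dom \<alpha> = A \<and> ran \<alpha> \<subseteq> carrier G})"
      by auto
    then show ?thesis
      using assms by (auto intro!: finite_set_of_finite_maps intro: finite_subset)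
  qed
  then show ?thesis
    by (rule finite_subset[rotated, OF finite_Pow_iff[THEN iffD2]])
      (auto simp: partial_gpartitions_def)
qed

lemma finite_partial_gpartition:
  assumes "finite X" "F \<in> partial_gpartitions G X"
  shows "finite F" and "card F \<le> card X"
proof -
  define f :: "('a \<rightharpoonup> 'b) \<Rightarrow> 'a" where "f \<alpha> = (SOME x. x \<in> dom \<alpha>)" for \<alpha>
  have f: "f \<alpha> \<in> dom \<alpha>" if "\<alpha> \<in> F" for \<alpha>
  proof -
    have "dom \<alpha> \<noteq> {}" using assms(2) that by (auto simp: partial_gpartitions_def)
    then show ?thesis unfolding f_def by (rule some_in_eq[THEN iffD2])
  qed
  have inj: "inj_on f F"
  proof (rule inj_onI, rule ccontr)
    fix \<alpha> \<beta> assume *: "\<alpha> \<in> F" "\<beta> \<in> F" "f \<alpha> = f \<beta>" "\<alpha> \<noteq> \<beta>"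
    then have "disjnt (dom \<alpha>) (dom \<beta>)"
      using assms(2) by (auto simp: partial_gpartitions_def pairwise_def)
    with f[OF *(1)] f[OF *(2)] *(3) show False by (auto simp: disjnt_iff)
  qed
  have sub: "f ` F \<subseteq> X"
    using f assms(2) by (fastforce simp: partial_gpartitions_def)
  show "finite F"
    using inj sub assms(1) by (meson finite_imageD finite_subset)
  show "card F \<le> card X"
    by (rule card_inj_on_le[OF inj sub assms(1)])
qed

context group
begin

lemma dowling_le_refl:
  assumes "F \<in> partial_gpartitions G X"
  shows "dowling_le G F F"
  unfolding dowling_le_def
proof
  fix \<alpha> assume "\<alpha> \<in> F"
  then have "ran \<alpha> \<subseteq> carrier G" using assms by (auto simp: partial_gpartitions_def)
  then have "the (\<alpha> x) = \<one> \<otimes> the (\<alpha> x)" if "x \<in> dom \<alpha>" for x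
    using that by (force intro: ranI simp: subset_iff)
  then show "\<exists>M\<subseteq>F. dom \<alpha> = (\<Union>\<alpha>\<in>M. dom \<alpha>) \<and>
      (\<forall>\<gamma>\<in>M. \<exists>c\<in>carrier G. \<forall>x\<in>dom \<gamma>. the (\<alpha> x) = c \<otimes> the (\<gamma> x))"
    using \<open>\<alpha> \<in> F\<close> by (intro exI[of _ "{\<alpha>}"]) auto
qed

lemma dowling_le_trans:
  assumes F: "F \<in> partial_gpartitions G X"
    and "dowling_le G F H" "dowling_le G H K"
  shows "dowling_le G F K"
  unfolding dowling_le_def
proof
  fix \<gamma> assume "\<gamma> \<in> K"
  then obtain M where M: "M \<subseteq> H" "dom \<gamma> = (\<Union>\<beta>\<in>M. dom \<beta>)"
      "\<forall>\<beta>\<in>M. \<exists>c\<in>carrier G. \<forall>x\<in>dom \<beta>. the (\<gamma> x) = c \<otimes> the (\<beta> x)"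
    using bspec[OF assms(3)[unfolded dowling_le_def] \<open>\<gamma> \<in> K\<close>]
    by (elim exE conjE) (rule that)
  have "\<forall>\<beta>\<in>M. \<exists>N\<subseteq>F. dom \<beta> = (\<Union>\<alpha>\<in>N. dom \<alpha>) \<and>
      (\<forall>\<alpha>\<in>N. \<exists>c\<in>carrier G. \<forall>x\<in>dom \<alpha>. the (\<beta> x) = c \<otimes> the (\<alpha> x))"
    using assms(2) M(1) unfolding dowling_le_def by (meson subsetD)
  from bchoice[OF this] obtain N where
    "\<forall>\<beta>\<in>M. N \<beta> \<subseteq> F \<and> dom \<beta> = (\<Union>\<alpha>\<in>N \<beta>. dom \<alpha>) \<and>
      (\<forall>\<alpha>\<in>N \<beta>. \<exists>c\<in>carrier G. \<forall>x\<in>dom \<alpha>. the (\<beta> x) = c \<otimes> the (\<alpha> x))"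
    by (elim exE) (rule that)
  then have N: "\<And>\<beta>. \<beta> \<in> M \<Longrightarrow> N \<beta> \<subseteq> F"
      "\<And>\<beta>. \<beta> \<in> M \<Longrightarrow> dom \<beta> = (\<Union>\<alpha>\<in>N \<beta>. dom \<alpha>)"
      "\<And>\<beta> \<alpha>. \<beta> \<in> M \<Longrightarrow> \<alpha> \<in> N \<beta> \<Longrightarrow>
         \<exists>c\<in>carrier G. \<forall>x\<in>dom \<alpha>. the (\<beta> x) = c \<otimes> the (\<alpha> x)"
    by (simp_all only:)
  have "\<exists>c\<in>carrier G. \<forall>x\<in>dom \<alpha>. the (\<gamma> x) = c \<otimes> the (\<alpha> x)"
    if "\<beta> \<in> M" "\<alpha> \<in> N \<beta>" for \<alpha> \<beta>
  proof -
    note \<beta> = that(1) and \<alpha> = that(2)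
    obtain c where c: "c \<in> carrier G" "\<forall>x\<in>dom \<beta>. the (\<gamma> x) = c \<otimes> the (\<beta> x)"
      using bspec[OF M(3) \<beta>] by (elim bexE) (rule that)
    obtain d where d: "d \<in> carrier G" "\<forall>x\<in>dom \<alpha>. the (\<beta> x) = d \<otimes> the (\<alpha> x)"
      using N(3)[OF \<beta> \<alpha>] by (elim bexE) (rule that)
    have "the (\<gamma> x) = (c \<otimes> d) \<otimes> the (\<alpha> x)" if x: "x \<in> dom \<alpha>" for x
    proof -
      have "x \<in> dom \<beta>" using N(2)[OF \<beta>] \<alpha> x by blast
      moreover have "\<alpha> \<in> F" using N(1)[OF \<beta>] \<alpha> by blast
      then have "ran \<alpha> \<subseteq> carrier G" using F by (auto simp: partial_gpartitions_def)
      then have "the (\<alpha> x) \<in> carrier G" using x by (auto intro: ranI)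
      ultimately show ?thesis using c d x by (simp add: m_assoc)
    qed
    then show ?thesis using c(1) d(1) by (intro bexI[of _ "c \<otimes> d"]) auto
  qed
  moreover have "dom \<gamma> = (\<Union>\<alpha>\<in>(\<Union>\<beta>\<in>M. N \<beta>). dom \<alpha>)"
    using M(2) N(2) by simp
  moreover have "(\<Union>\<beta>\<in>M. N \<beta>) \<subseteq> F"
    using N(1) by blast
  ultimately show "\<exists>M\<subseteq>F. dom \<gamma> = (\<Union>\<alpha>\<in>M. dom \<alpha>) \<and>
      (\<forall>\<alpha>\<in>M. \<exists>c\<in>carrier G. \<forall>x\<in>dom \<alpha>. the (\<gamma> x) = c \<otimes> the (\<alpha> x))"
    by (intro exI[of _ "\<Union>\<beta>\<in>M. N \<beta>"] conjI ballI) (auto simp only: UN_iff)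
qed

lemma equiv_dowling_equiv:
  "equiv (partial_gpartitions G X) (dowling_equiv G X)"
proof (rule equivI)
  show "dowling_equiv G X \<subseteq> partial_gpartitions G X \<times> partial_gpartitions G X"
    by (auto simp: dowling_equiv_def)
  show "refl_on (partial_gpartitions G X) (dowling_equiv G X)"
    by (auto simp: dowling_equiv_def refl_on_def dowling_le_refl)
  show "sym (dowling_equiv G X)"
    by (auto simp: dowling_equiv_def sym_def)
  show "trans (dowling_equiv G X)"
    unfolding trans_def dowling_equiv_def using dowling_le_trans by blast
qed

lemma dowling_classD:
  assumes "C \<in> partial_gpartitions G X // dowling_equiv G X"
  shows "C \<noteq> {}" and "C \<subseteq> partial_gpartitions G X"
    and "\<And>F H. F \<in> C \<Longrightarrow> H \<in> C \<Longrightarrow> dowling_le G F H"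
proof -
  show "C \<noteq> {}"
    using assms equiv_dowling_equiv in_quotient_imp_non_empty by blast
  show "C \<subseteq> partial_gpartitions G X"
    by (rule in_quotient_imp_subset[OF equiv_dowling_equiv assms])
  show "dowling_le G F H" if "F \<in> C" "H \<in> C" for F H
    using in_quotient_imp_in_rel[OF equiv_dowling_equiv assms, of F H] that
    by (auto simp: dowling_equiv_def)
qed

lemma partial_order_dowling_lattice: "partial_order (dowling_lattice G X)"
proof -
  let ?Q = "partial_gpartitions G X // dowling_equiv G X"
  have antisym: "C = D"
    if C: "C \<in> ?Q" and D: "D \<in> ?Q" and F: "F \<in> C" "F' \<in> C" and H: "H \<in> D" "H' \<in> D"
      and le: "dowling_le G F H" "dowling_le G H' F'" for C D F F' H H'
  proof -
    note part = dowling_classD(2)[OF C] dowling_classD(2)[OF D]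
    have "dowling_le G H H'" "dowling_le G F' F"
      using C D F H dowling_classD(3) by blast+
    then have "dowling_le G H F"
      using le part F H by (meson dowling_le_trans subsetD)
    then have "(F, H) \<in> dowling_equiv G X"
      using le part F H by (auto simp: dowling_equiv_def)
    then show ?thesis
      by (rule quotient_eqI[OF equiv_dowling_equiv C D F(1) H(1)])
  qed
  have trans: "\<exists>F\<in>C. \<exists>K\<in>E. dowling_le G F K"
    if C: "C \<in> ?Q" and D: "D \<in> ?Q" and "F \<in> C" "H \<in> D" "H' \<in> D" "K \<in> E"
      and "dowling_le G F H" "dowling_le G H' K" for C D E F H H' K
  proof -
    have "dowling_le G H H'" using D that dowling_classD(3) by blast
    then have "dowling_le G F K"
      using that dowling_classD(2)[OF C] dowling_classD(2)[OF D]
      by (meson dowling_le_trans subsetD)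
    then show ?thesis using that by blast
  qed
  let ?L = "dowling_lattice G X"
  have L [simp]: "carrier ?L = ?Q" "(.=\<^bsub>?L\<^esub>) = (=)"
    "\<And>C D. C \<sqsubseteq>\<^bsub>?L\<^esub> D \<longleftrightarrow> (\<exists>F\<in>C. \<exists>H\<in>D. dowling_le G F H)"
    by (simp_all add: dowling_lattice_def)
  show ?thesis
  proof
    fix C assume "C \<in> carrier ?L"
    then have C: "C \<in> ?Q" by simp
    obtain F where "F \<in> C" using dowling_classD(1)[OF C] by blast
    then show "C \<sqsubseteq>\<^bsub>?L\<^esub> C" using dowling_classD(3)[OF C] by auto
  next
    fix C D assume "C \<sqsubseteq>\<^bsub>?L\<^esub> D" "D \<sqsubseteq>\<^bsub>?L\<^esub> C" "C \<in> carrier ?L" "D \<in> carrier ?L"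
    then show "C .=\<^bsub>?L\<^esub> D" unfolding L using antisym by blast
  next
    fix C D E
    assume "C \<sqsubseteq>\<^bsub>?L\<^esub> D" "D \<sqsubseteq>\<^bsub>?L\<^esub> E"
      "C \<in> carrier ?L" "D \<in> carrier ?L" "E \<in> carrier ?L"
    then show "C \<sqsubseteq>\<^bsub>?L\<^esub> E" unfolding L using trans by blast
  qed simp_all
qed

lemma finite_dowling_lattice:
  assumes "finite X" "finite (carrier G)"
  shows "finite (carrier (dowling_lattice G X))"
  using finite_quotient[OF finite_partial_gpartitions[OF assms], of "dowling_equiv G X"]
  by (simp add: dowling_lattice_def dowling_equiv_def subset_iff)

lemma least_dowling_zero:
  "least (dowling_lattice G X) (dowling_zero G X) (carrier (dowling_lattice G X))"
proof -
  let ?E = "(\<lambda>x. [x \<mapsto> \<one>]) ` X"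
  have E: "?E \<in> partial_gpartitions G X"
    by (auto simp: partial_gpartitions_def pairwise_def disjnt_iff split: if_splits)
  then have mem: "?E \<in> dowling_zero G X"
    using equiv_class_self[OF equiv_dowling_equiv] by (simp add: dowling_zero_def)
  have le: "dowling_le G ?E F" if F: "F \<in> partial_gpartitions G X" for F
    unfolding dowling_le_def
  proof
    fix \<alpha> assume "\<alpha> \<in> F"
    then have \<alpha>: "dom \<alpha> \<subseteq> X" "ran \<alpha> \<subseteq> carrier G"
      using F by (auto simp: partial_gpartitions_def)
    then have val: "the (\<alpha> x) \<in> carrier G" if "x \<in> dom \<alpha>" for x
      using that by (auto intro: ranI)
    have "\<exists>c\<in>carrier G. \<forall>y\<in>dom [x \<mapsto> \<one>]. the (\<alpha> y) = c \<otimes> the ([x \<mapsto> \<one>] y)"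
      if "x \<in> dom \<alpha>" for x
      using val[OF that] by (intro bexI[of _ "the (\<alpha> x)"]) auto
    then show "\<exists>M\<subseteq>?E. dom \<alpha> = (\<Union>\<alpha>\<in>M. dom \<alpha>) \<and>
        (\<forall>\<beta>\<in>M. \<exists>c\<in>carrier G. \<forall>x\<in>dom \<beta>. the (\<alpha> x) = c \<otimes> the (\<beta> x))"
      using \<alpha>(1) by (intro exI[of _ "(\<lambda>x. [x \<mapsto> \<one>]) ` dom \<alpha>"] conjI) auto
  qed
  have "dowling_zero G X \<sqsubseteq>\<^bsub>dowling_lattice G X\<^esub> C"
    if C: "C \<in> carrier (dowling_lattice G X)" for C
  proof -
    have C': "C \<in> partial_gpartitions G X // dowling_equiv G X"
      using C by (simp add: dowling_lattice_def)
    obtain F where "F \<in> C" "F \<in> partial_gpartitions G X"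
      using dowling_classD(1,2)[OF C'] by blast
    then show ?thesis using mem le by (auto simp: dowling_lattice_def)
  qed
  moreover have "dowling_zero G X \<in> carrier (dowling_lattice G X)"
    using E by (auto simp: dowling_lattice_def dowling_zero_def intro: quotientI)
  ultimately show ?thesis
    by (auto simp: least_def Upper_def)
qed

lemma dowling_le_card:
  assumes "finite X" "F \<in> partial_gpartitions G X" "H \<in> partial_gpartitions G X"
    and le: "dowling_le G F H"
  shows "card H \<le> card F"
proof -
  have "\<exists>\<alpha>\<in>F. dom \<alpha> \<subseteq> dom \<beta> \<and> dom \<alpha> \<noteq> {}" if \<beta>: "\<beta> \<in> H" for \<beta>
  proof -
    obtain M where M: "M \<subseteq> F" "dom \<beta> = (\<Union>\<alpha>\<in>M. dom \<alpha>)"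
      using bspec[OF le[unfolded dowling_le_def] \<beta>]
      by (elim exE conjE) (rule that)
    have "dom \<beta> \<noteq> {}" using assms(3) \<beta> by (auto simp: partial_gpartitions_def)
    then obtain x where "x \<in> dom \<beta>" by blast
    then obtain \<alpha> where "\<alpha> \<in> M" "x \<in> dom \<alpha>" using M(2) by (auto simp only: UN_iff)
    moreover have "dom \<alpha> \<subseteq> dom \<beta>"
      unfolding M(2) by (rule UN_upper) fact
    ultimately show ?thesis using M(1) by (intro bexI[of _ \<alpha>]) auto
  qed
  then have "\<forall>\<beta>\<in>H. \<exists>\<alpha>. \<alpha> \<in> F \<and> dom \<alpha> \<subseteq> dom \<beta> \<and> dom \<alpha> \<noteq> {}"
    by blast
  from bchoice[OF this] obtain g where
    "\<forall>\<beta>\<in>H. g \<beta> \<in> F \<and> dom (g \<beta>) \<subseteq> dom \<beta> \<and> dom (g \<beta>) \<noteq> {}"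
    by (elim exE) (rule that)
  then have g: "\<And>\<beta>. \<beta> \<in> H \<Longrightarrow> g \<beta> \<in> F"
      "\<And>\<beta>. \<beta> \<in> H \<Longrightarrow> dom (g \<beta>) \<subseteq> dom \<beta>" "\<And>\<beta>. \<beta> \<in> H \<Longrightarrow> dom (g \<beta>) \<noteq> {}"
    by blast+
  have "inj_on g H"
  proof (rule inj_onI, rule ccontr)
    fix \<beta> \<gamma> assume *: "\<beta> \<in> H" "\<gamma> \<in> H" "g \<beta> = g \<gamma>" "\<beta> \<noteq> \<gamma>"
    then have "disjnt (dom \<beta>) (dom \<gamma>)"
      using assms(3) by (auto simp: partial_gpartitions_def pairwise_def)
    moreover obtain x where "x \<in> dom (g \<beta>)" using g(3)[OF *(1)] by blast
    then have "x \<in> dom \<beta>" "x \<in> dom \<gamma>"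
      using g(2)[OF *(1)] g(2)[OF *(2)] *(3) by auto
    ultimately show False by (auto simp: disjnt_iff)
  qed
  then show ?thesis
    using g(1) finite_partial_gpartition(1)[OF assms(1,2)] by (intro card_inj_on_le) auto
qed

lemma dowling_rank_eq:
  assumes "finite X" "C \<in> carrier (dowling_lattice G X)" "F \<in> C"
  shows "dowling_rank X C = int (card X) - int (card F)"
proof -
  have C: "C \<in> partial_gpartitions G X // dowling_equiv G X"
    using assms(2) by (simp add: dowling_lattice_def)
  have "card H = card F" if "H \<in> C" for H
    using dowling_classD(2,3)[OF C] that assms(1,3)
    by (meson dowling_le_card le_antisym subsetD)
  then have "(\<lambda>F. int (card X) - int (card F)) ` C = (\<lambda>_. int (card X) - int (card F)) ` C"
    by (intro image_cong) simp_all
  also have "\<dots> = {int (card X) - int (card F)}"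
    using assms(3) by auto
  finally show ?thesis by (simp add: dowling_rank_def)
qed

lemma dowling_rank_nonneg:
  assumes "finite X" "C \<in> carrier (dowling_lattice G X)"
  shows "0 \<le> dowling_rank X C"
proof -
  have C: "C \<in> partial_gpartitions G X // dowling_equiv G X"
    using assms(2) by (simp add: dowling_lattice_def)
  obtain F where F: "F \<in> C" "F \<in> partial_gpartitions G X"
    using dowling_classD(1,2)[OF C] by auto
  then show ?thesis
    using dowling_rank_eq[OF assms F(1)] finite_partial_gpartition(2)[OF assms(1) F(2)] by simp
qed

lemma whitney_eq_0:
  assumes "n < k"
  shows "whitney1 G n k = 0" and "whitney2 G n k = 0"
proof -
  have "{x \<in> carrier (dowling_lattice G {1..n}). dowling_rank {1..n} x = int n - int k} = {}"
  proof (intro equals0I, elim CollectE conjE)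
    fix x
    assume "x \<in> carrier (dowling_lattice G {1..n})" "dowling_rank {1..n} x = int n - int k"
    then show False using assms dowling_rank_nonneg[of "{1..n}" x] by simp
  qed
  then show "whitney1 G n k = 0" "whitney2 G n k = 0"
    unfolding whitney1_def whitney2_def by (simp_all only: sum.empty)
qed

lemma shifted_convolution_eq_sum:
  "shifted_convolution G n t s = (\<Sum>k\<le>n. whitney1 G n k * whitney2 G (k + s) t)"
  unfolding shifted_convolution_def
proof (rule Sum_any.expand_superset)
  show "{k. whitney1 G n k * whitney2 G (k + s) t \<noteq> 0} \<subseteq> {..n}"
    using whitney_eq_0(1)[of n] by (metis (mono_tags, lifting) atMost_iff mem_Collect_eq
        mult_zero_left not_le subsetI)
qed simp

end

end

theory Submission
  imports Defs
begin

text \<open>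
  The idea is to count colourings. Given \<open>q\<close>, colour the points of \<open>X\<close> with the
  \<open>1 + m q\<close> colours \<open>None\<close> and \<open>(g, i)\<close>, \<open>g \<in> G\<close>, \<open>i < q\<close>. The points coloured with a
  fixed \<open>i\<close> carry a map to \<open>G\<close>, and these maps form a partial \<open>G\<close>-partition, the kernel of the
  colouring. A colouring whose kernel lies above \<open>F\<close> is given by one free choice of a colour for
  each block of \<open>F\<close>, so there are \<open>(1 + m q) ^ |F|\<close> of them (\<open>card_colourings_above\<close>). The kernel
  is equivalent to \<open>F\<close> itself exactly when the choices avoid \<open>None\<close> and use distinct indices \<open>i\<close>,
  which leaves \<open>p k q = (\<Prod>i<k. m (q - i))\<close> colourings, where \<open>k = |F|\<close>
  (\<open>card_colourings_equiv\<close>). Sorting the colourings above \<open>F\<close> by the class of their kernel gives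
  \<open>\<Sum> p |D| q = (1 + m q) ^ |F|\<close>, the sum being over all classes \<open>D\<close> above the class of \<open>F\<close>
  (\<open>sum_proper_count_above\<close>).

  At the least element this is \<open>\<Sum>t. W(k, t) p t q = (1 + m q) ^ k\<close> (\<open>sum_whitney2\<close>), while
  Moebius inversion turns it into \<open>\<Sum>k. w(n, k) (1 + m q) ^ k = p n q\<close> (\<open>sum_whitney1\<close>). Hence
  for every \<open>q\<close>

    \<open>\<Sum>t. c(n, t, s) p t q = \<Sum>k. w(n, k) (1 + m q) ^ (k + s) = p n q (1 + m q) ^ s\<close>.

  Since \<open>p t q\<close> vanishes for \<open>q < t\<close> but not for \<open>q = t\<close>, these equations determine the
  coefficients \<open>c(n, t, s)\<close> (\<open>proper_count_coeffs_unique\<close>). From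
  \<open>(1 + m q) p t q = p (t + 1) q + (1 + t m) p t q\<close> one reads off \<open>c(n, t, 0) = \<delta>(n, t)\<close> and
  \<open>c(n, t, s + 1) = c(n, t - 1, s) + (1 + t m) c(n, t, s)\<close>. The vanishing for \<open>t < n\<close> follows by
  induction on \<open>s\<close>. For \<open>t \<ge> n\<close> the recurrence says that the generating function of the
  \<open>c(n, t, s)\<close>, multiplied by \<open>1 - (1 + t m) x\<close>, is \<open>1\<close> if \<open>t = n\<close> and \<open>x\<close> times the one for
  \<open>t - 1\<close> if \<open>t > n\<close>, which is the product formula.
\<close>

section \<open>Moebius inversion at the least element\<close>

lemma sum_mobius:
  fixes P (structure)
  assumes P: "partial_order P" "finite (carrier P)" and b: "least P b (carrier P)"
    and z: "z \<in> carrier P"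
  shows "(\<Sum>x\<in>{x \<in> carrier P. x \<sqsubseteq> z}. mobius P b x) = (if z = b then 1 else 0)"
proof -
  interpret partial_order P by fact
  have b': "b \<in> carrier P" "\<And>x. x \<in> carrier P \<Longrightarrow> b \<sqsubseteq> x"
    using b by (auto simp: least_def)
  show ?thesis
  proof (cases "z = b")
    case True
    then have "{x \<in> carrier P. x \<sqsubseteq> z} = {b}"
      using b' le_refl antisym by (auto simp: eq_is_equal)
    then show ?thesis
      using True mobius_refl[OF P b'(1)] by simp
  next
    case False
    then have "b \<sqsubset> z"
      using b' z by (simp add: lless_def eq_is_equal)
    moreover have "{x \<in> carrier P. x \<sqsubseteq> z} = insert z {x \<in> carrier P. b \<sqsubseteq> x \<and> x \<sqsubset> z}"
      using b' z le_refl by (auto simp: lless_def eq_is_equal)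
    moreover have "z \<notin> {x \<in> carrier P. b \<sqsubseteq> x \<and> x \<sqsubset> z}"
      by (simp add: lless_def eq_is_equal)
    ultimately show ?thesis
      using False P(2) mobius_less[OF P z, of b] by simp
  qed
qed

text \<open>
  After exchanging the sums, the coefficient of \<open>f z\<close> is the sum of \<open>mobius P b x\<close> over all
  \<open>x\<close> below \<open>z\<close>, which vanishes unless \<open>z\<close> is the least element.
\<close>
lemma mobius_inversion_at_least:
  fixes P (structure) and f g :: "'a \<Rightarrow> int"
  assumes P: "partial_order P" "finite (carrier P)" and b: "least P b (carrier P)"
    and g: "\<And>x. x \<in> carrier P \<Longrightarrow> g x = (\<Sum>z\<in>{z \<in> carrier P. x \<sqsubseteq> z}. f z)"
  shows "(\<Sum>x\<in>carrier P. mobius P b x * g x) = f b"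
proof -
  have "b \<in> carrier P"
    using b by (simp add: least_def)
  have "(\<Sum>x\<in>carrier P. mobius P b x * g x)
      = (\<Sum>x\<in>carrier P. \<Sum>z\<in>{z \<in> carrier P. x \<sqsubseteq> z}. mobius P b x * f z)"
    by (simp add: g sum_distrib_left)
  also have "\<dots> = (\<Sum>z\<in>carrier P. \<Sum>x\<in>{x \<in> carrier P. x \<sqsubseteq> z}. mobius P b x * f z)"
    using P(2) by (intro sum.swap_restrict) auto
  also have "\<dots> = (\<Sum>z\<in>carrier P. (if z = b then 1 else 0) * f z)"
    by (simp add: sum_mobius[OF P b, symmetric] sum_distrib_right)
  also have "\<dots> = f b"
    using P(2) \<open>b \<in> carrier P\<close> by (simp add: if_distrib[where f = "\<lambda>c. c * _"] cong: if_cong)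
  finally show ?thesis .
qed

section \<open>Colourings and their kernels\<close>

definition colourings ::
    "('g, 'b) monoid_scheme \<Rightarrow> 'a set \<Rightarrow> nat \<Rightarrow> ('a \<rightharpoonup> 'g \<times> nat) set" where
  "colourings G X q = {f. dom f \<subseteq> X \<and> ran f \<subseteq> carrier G \<times> {..<q}}"

text \<open>
  The second component of a colour tells which block a point belongs to, the first one is the value
  of the block map there.
\<close>
definition colour_block :: "('a \<rightharpoonup> 'g \<times> nat) \<Rightarrow> nat \<Rightarrow> ('a \<rightharpoonup> 'g)" where
  "colour_block f i x = (case f x of None \<Rightarrow> None | Some (g, j) \<Rightarrow> if j = i then Some g else None)"

definition colour_kernel :: "('a \<rightharpoonup> 'g \<times> nat) \<Rightarrow> ('a \<rightharpoonup> 'g) set" where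
  "colour_kernel f = colour_block f ` {i. dom (colour_block f i) \<noteq> {}}"

definition palette :: "('g, 'b) monoid_scheme \<Rightarrow> nat \<Rightarrow> ('g \<times> nat) option set" where
  "palette G q = insert None (Some ` (carrier G \<times> {..<q}))"

text \<open>
  A choice of a colour for each block is spread over the points by left multiplication with the
  block map: relative to \<open>\<alpha>\<close>, the colour \<open>(c, i)\<close> stands for the multiple \<open>c \<otimes> \<alpha>\<close> with index
  \<open>i\<close>. Points outside all blocks are forced to \<open>None\<close>, because every block of a
  larger partial partition is a union of blocks.
\<close>
definition spread ::
    "('g, 'b) monoid_scheme \<Rightarrow> ('a \<rightharpoonup> 'g) set \<Rightarrow> (('a \<rightharpoonup> 'g) \<Rightarrow> ('g \<times> nat) option) \<Rightarrow>
      ('a \<rightharpoonup> 'g \<times> nat)" where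
  "spread G F \<phi> x =
     (if \<exists>\<alpha>\<in>F. x \<in> dom \<alpha>
      then let \<alpha> = THE \<alpha>. \<alpha> \<in> F \<and> x \<in> dom \<alpha>
           in map_option (\<lambda>(c, i). (c \<otimes>\<^bsub>G\<^esub> the (\<alpha> x), i)) (\<phi> \<alpha>)
      else None)"

lemma colour_block_eq_Some [simp]: "colour_block f i x = Some g \<longleftrightarrow> f x = Some (g, i)"
  by (auto simp: colour_block_def split: option.splits if_splits)

lemma in_dom_colour_block: "x \<in> dom (colour_block f i) \<longleftrightarrow> (\<exists>g. f x = Some (g, i))"
  by (simp add: dom_def)

lemma kernel_iff:
  "\<beta> \<in> colour_kernel f \<longleftrightarrow> (\<exists>i x g. \<beta> = colour_block f i \<and> f x = Some (g, i))"
proof -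
  have "dom (colour_block f i) \<noteq> {} \<longleftrightarrow> (\<exists>x g. f x = Some (g, i))" for i
    by (simp only: ex_in_conv[symmetric] in_dom_colour_block)
  then show ?thesis
    by (simp only: colour_kernel_def image_iff Bex_def mem_Collect_eq) (simp only: ex_simps conj_commute)
qed

lemma kernel_in_partial_gpartitions:
  assumes "f \<in> colourings G X q"
  shows "colour_kernel f \<in> partial_gpartitions G X"
proof -
  have f: "x \<in> X \<and> g \<in> carrier G" if "f x = Some (g, i)" for x g i
    using assms that domI[of f] ranI[of f] unfolding colourings_def by blast
  have "dom \<beta> \<noteq> {} \<and> dom \<beta> \<subseteq> X \<and> ran \<beta> \<subseteq> carrier G" if "\<beta> \<in> colour_kernel f" for \<beta>
  proof -
    obtain i where i: "\<beta> = colour_block f i" "dom \<beta> \<noteq> {}"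
      using \<open>\<beta> \<in> colour_kernel f\<close> unfolding colour_kernel_def by blast
    have "ran (colour_block f i) \<subseteq> carrier G"
      unfolding ran_def using f by auto
    moreover have "dom (colour_block f i) \<subseteq> X"
      using f by (meson in_dom_colour_block subsetI)
    ultimately show ?thesis
      using i by blast
  qed
  moreover have "pairwise (\<lambda>\<alpha> \<beta>. disjnt (dom \<alpha>) (dom \<beta>)) (colour_kernel f)"
  proof (rule pairwiseI)
    fix \<alpha> \<beta> assume "\<alpha> \<in> colour_kernel f" "\<beta> \<in> colour_kernel f" "\<alpha> \<noteq> \<beta>"
    then obtain i j where "\<alpha> = colour_block f i" "\<beta> = colour_block f j" "i \<noteq> j"
      unfolding colour_kernel_def by blast
    then show "disjnt (dom \<alpha>) (dom \<beta>)"
      by (auto simp: disjnt_iff in_dom_colour_block simp del: domIff)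
  qed
  ultimately show ?thesis
    by (simp add: partial_gpartitions_def)
qed

lemma block_unique:
  assumes "F \<in> partial_gpartitions G X" "\<alpha> \<in> F" "\<beta> \<in> F" "x \<in> dom \<alpha>" "x \<in> dom \<beta>"
  shows "\<alpha> = \<beta>"
proof (rule ccontr)
  assume "\<alpha> \<noteq> \<beta>"
  then have "disjnt (dom \<alpha>) (dom \<beta>)"
    using assms(1-3) by (auto simp: partial_gpartitions_def pairwise_def)
  then show False
    using assms(4,5) by (simp add: disjnt_iff)
qed

lemma spread_block:
  assumes "F \<in> partial_gpartitions G X" "\<alpha> \<in> F" "x \<in> dom \<alpha>"
  shows "spread G F \<phi> x = map_option (\<lambda>(c, i). (c \<otimes>\<^bsub>G\<^esub> the (\<alpha> x), i)) (\<phi> \<alpha>)"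
proof -
  have "(THE \<alpha>. \<alpha> \<in> F \<and> x \<in> dom \<alpha>) = \<alpha>"
    using assms block_unique[OF assms(1)] by (intro the_equality) auto
  then show ?thesis
    using assms by (auto simp: spread_def)
qed

lemma spread_SomeE:
  assumes "F \<in> partial_gpartitions G X" "spread G F \<phi> x = Some (g, i)"
  obtains \<alpha> c where "\<alpha> \<in> F" "x \<in> dom \<alpha>" "\<phi> \<alpha> = Some (c, i)" "g = c \<otimes>\<^bsub>G\<^esub> the (\<alpha> x)"
proof -
  obtain \<alpha> where \<alpha>: "\<alpha> \<in> F" "x \<in> dom \<alpha>"
    using assms(2) by (auto simp: spread_def split: if_splits)
  then show ?thesis
    using that[of \<alpha>] assms(2) spread_block[OF assms(1) \<alpha>] by auto
qed

lemma block_value: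
  assumes "F \<in> partial_gpartitions G X" "\<alpha> \<in> F" "x \<in> dom \<alpha>"
  shows "x \<in> X" "the (\<alpha> x) \<in> carrier G"
proof -
  have "dom \<alpha> \<subseteq> X" "ran \<alpha> \<subseteq> carrier G"
    using assms(1,2) by (simp_all add: partial_gpartitions_def)
  moreover obtain g where "\<alpha> x = Some g"
    using assms(3) by blast
  ultimately show "x \<in> X" "the (\<alpha> x) \<in> carrier G"
    using assms(3) by (auto intro: ranI)
qed

lemma block_nonempty:
  assumes "F \<in> partial_gpartitions G X" "\<alpha> \<in> F"
  obtains x where "x \<in> dom \<alpha>"
proof -
  have "dom \<alpha> \<noteq> {}"
    using assms by (simp add: partial_gpartitions_def)
  then show ?thesis
    using that by blast
qed

context group
begin

lemma palette_SomeD: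
  assumes "\<phi> \<in> F \<rightarrow>\<^sub>E palette G q" "\<alpha> \<in> F" "\<phi> \<alpha> = Some (c, i)"
  shows "c \<in> carrier G" "i < q"
  using PiE_mem[OF assms(1,2)] assms(3) by (auto simp: palette_def)

lemma spread_in_colourings:
  assumes F: "F \<in> partial_gpartitions G X" and \<phi>: "\<phi> \<in> F \<rightarrow>\<^sub>E palette G q"
  shows "spread G F \<phi> \<in> colourings G X q"
proof -
  have "x \<in> X \<and> g \<in> carrier G \<and> i < q" if "spread G F \<phi> x = Some (g, i)" for x g i
    using that
    by (elim spread_SomeE[OF F]) (use block_value[OF F] palette_SomeD[OF \<phi>] in auto)
  then show ?thesis
    unfolding colourings_def ran_def dom_def by force
qed

text \<open>
  The kernel block with index \<open>i\<close> is the union of the blocks whose chosen colour has index \<open>i\<close>,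
  and on each of them it is the chosen multiple.
\<close>
lemma dowling_le_kernel_spread:
  assumes F: "F \<in> partial_gpartitions G X" and \<phi>: "\<phi> \<in> F \<rightarrow>\<^sub>E palette G q"
  shows "dowling_le G F (colour_kernel (spread G F \<phi>))"
  unfolding dowling_le_def
proof
  fix \<beta> assume "\<beta> \<in> colour_kernel (spread G F \<phi>)"
  then obtain i where \<beta>: "\<beta> = colour_block (spread G F \<phi>) i"
    by (auto simp: kernel_iff)
  define M where "M = {\<alpha>\<in>F. \<exists>c. \<phi> \<alpha> = Some (c, i)}"
  have val: "\<beta> x = Some (c \<otimes> the (\<alpha> x))"
    if "\<alpha> \<in> F" "\<phi> \<alpha> = Some (c, i)" "x \<in> dom \<alpha>" for \<alpha> c x
    using spread_block[OF F that(1,3)] that(2) by (simp add: \<beta>)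
  have 1: "dom \<beta> = (\<Union>\<alpha>\<in>M. dom \<alpha>)"
  proof
    show "dom \<beta> \<subseteq> (\<Union>\<alpha>\<in>M. dom \<alpha>)"
    proof
      fix x assume "x \<in> dom \<beta>"
      then obtain g where "spread G F \<phi> x = Some (g, i)"
        unfolding \<beta> in_dom_colour_block by blast
      then show "x \<in> (\<Union>\<alpha>\<in>M. dom \<alpha>)"
        by (rule spread_SomeE[OF F]) (use M_def in blast)
    qed
    show "(\<Union>\<alpha>\<in>M. dom \<alpha>) \<subseteq> dom \<beta>"
      using val unfolding M_def by blast
  qed
  have 2: "\<forall>\<alpha>\<in>M. \<exists>c\<in>carrier G. \<forall>x\<in>dom \<alpha>. the (\<beta> x) = c \<otimes> the (\<alpha> x)"
  proof
    fix \<alpha> assume "\<alpha> \<in> M"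
    then obtain c where c: "\<alpha> \<in> F" "\<phi> \<alpha> = Some (c, i)"
      unfolding M_def by blast
    then show "\<exists>c\<in>carrier G. \<forall>x\<in>dom \<alpha>. the (\<beta> x) = c \<otimes> the (\<alpha> x)"
      using palette_SomeD(1)[OF \<phi>, OF c] val[OF c] by (intro bexI[of _ c] ballI) simp_all
  qed
  have 3: "M \<subseteq> F"
    unfolding M_def by blast
  show "\<exists>M\<subseteq>F. dom \<beta> = (\<Union>\<alpha>\<in>M. dom \<alpha>) \<and>
      (\<forall>\<alpha>\<in>M. \<exists>c\<in>carrier G. \<forall>x\<in>dom \<alpha>. the (\<beta> x) = c \<otimes> the (\<alpha> x))"
    using 1 2 3 by (intro exI[of _ M] conjI)
qed

text \<open>
  If the kernel lies above \<open>F\<close>, then a colouring is on each block \<open>\<alpha>\<close> of \<open>F\<close> either constantly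
  \<open>None\<close> or of the form \<open>(c \<otimes> \<alpha> x, i)\<close> with \<open>c\<close> and \<open>i\<close> fixed. So one point of the block
  determines the colour of the block.
\<close>
lemma colouring_is_spread:
  assumes F: "F \<in> partial_gpartitions G X" and f: "f \<in> colourings G X q"
    and le: "dowling_le G F (colour_kernel f)"
  shows "f \<in> spread G F ` (F \<rightarrow>\<^sub>E palette G q)"
proof -
  have fval: "g \<in> carrier G \<and> i < q" if "f x = Some (g, i)" for x g i
    using f that by (auto simp: colourings_def ran_def)
  \<comment> \<open>A coloured point lies in a block of \<open>F\<close>, since its kernel block is a union of such blocks.\<close>
  have over: "\<exists>\<alpha>\<in>F. \<exists>c\<in>carrier G. x \<in> dom \<alpha> \<and> (\<forall>z\<in>dom \<alpha>. f z = Some (c \<otimes> the (\<alpha> z), i))"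
    if x: "f x = Some (g, i)" for x g i
  proof -
    have \<beta>: "colour_block f i \<in> colour_kernel f"
      using x by (auto simp: kernel_iff)
    obtain M where M: "M \<subseteq> F" "dom (colour_block f i) = (\<Union>\<alpha>\<in>M. dom \<alpha>)"
        "\<forall>\<alpha>\<in>M. \<exists>c\<in>carrier G. \<forall>z\<in>dom \<alpha>. the (colour_block f i z) = c \<otimes> the (\<alpha> z)"
      using bspec[OF le[unfolded dowling_le_def] \<beta>] by (elim exE conjE) (rule that)
    have "x \<in> dom (colour_block f i)"
      using x by (simp add: in_dom_colour_block)
    then obtain \<alpha> where \<alpha>: "\<alpha> \<in> M" "x \<in> dom \<alpha>"
      unfolding M(2) by blast
    obtain c where c: "c \<in> carrier G" "\<forall>z\<in>dom \<alpha>. the (colour_block f i z) = c \<otimes> the (\<alpha> z)"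
      using bspec[OF M(3) \<alpha>(1)] by blast
    have "f z = Some (c \<otimes> the (\<alpha> z), i)" if z: "z \<in> dom \<alpha>" for z
    proof -
      have "z \<in> dom (colour_block f i)"
        unfolding M(2) using \<alpha>(1) z by blast
      then show ?thesis
        using c(2) z by (force simp: domIff simp flip: colour_block_eq_Some)
    qed
    then show ?thesis
      using \<alpha> c(1) M(1) by blast
  qed
  define rep where "rep \<alpha> = (SOME x. x \<in> dom \<alpha>)" for \<alpha> :: "'c \<rightharpoonup> 'a"
  have rep: "rep \<alpha> \<in> dom \<alpha>" if "\<alpha> \<in> F" for \<alpha>
    unfolding rep_def using block_nonempty[OF F that] by (metis someI)
  \<comment> \<open>The multiplier is recovered from the colour of a representative point.\<close>
  define \<phi> where "\<phi> = (\<lambda>\<alpha>\<in>F.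
    map_option (\<lambda>(g, i). (g \<otimes> inv (the (\<alpha> (rep \<alpha>))), i)) (f (rep \<alpha>)))"
  have "\<phi> \<in> F \<rightarrow>\<^sub>E palette G q"
  proof (rule PiE_I)
    fix \<alpha> assume "\<alpha> \<in> F"
    then show "\<phi> \<alpha> \<in> palette G q"
      using block_value(2)[OF F _ rep, of \<alpha>] fval
      by (cases "f (rep \<alpha>)") (auto simp: \<phi>_def palette_def)
  qed (simp add: \<phi>_def)
  moreover have "f = spread G F \<phi>"
  proof
    fix x
    show "f x = spread G F \<phi> x"
    proof (cases "\<exists>\<alpha>\<in>F. x \<in> dom \<alpha>")
      case False
      then have "f x = None"
        using over by (metis option.exhaust surj_pair)
      then show ?thesis
        using False by (simp add: spread_def)
    next
      case True
      then obtain \<alpha> where \<alpha>: "\<alpha> \<in> F" "x \<in> dom \<alpha>"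
        by blast
      note vals = block_value(2)[OF F \<alpha>(1)]
      show ?thesis
      proof (cases "\<exists>z\<in>dom \<alpha>. f z \<noteq> None")
        case True
        then obtain z g i where z: "z \<in> dom \<alpha>" "f z = Some (g, i)"
          by auto
        obtain \<alpha>' c where c: "\<alpha>' \<in> F" "c \<in> carrier G" "z \<in> dom \<alpha>'"
            "\<forall>z\<in>dom \<alpha>'. f z = Some (c \<otimes> the (\<alpha>' z), i)"
          using over[OF z(2)] by blast
        have "\<alpha>' = \<alpha>"
          using block_unique[OF F c(1) \<alpha>(1) c(3) z(1)] .
        then have fx: "f z = Some (c \<otimes> the (\<alpha> z), i)" if "z \<in> dom \<alpha>" for z
          using c(4) that by blast
        have "\<phi> \<alpha> = Some (c, i)"
          using fx[OF rep[OF \<alpha>(1)]] vals[OF rep[OF \<alpha>(1)]] \<alpha>(1) c(2)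
          by (simp add: \<phi>_def m_assoc)
        then show ?thesis
          using spread_block[OF F \<alpha>] fx[OF \<alpha>(2)] by simp
      next
        case False
        then have "f (rep \<alpha>) = None" "f x = None"
          using rep[OF \<alpha>(1)] \<alpha>(2) by blast+
        then have "\<phi> \<alpha> = None" "f x = None"
          using \<alpha>(1) by (simp_all add: \<phi>_def)
        then show ?thesis
          using spread_block[OF F \<alpha>] by simp
      qed
    qed
  qed
  ultimately show ?thesis
    by (intro image_eqI[where f = "spread G F" and x = \<phi>])
qed

lemma colourings_above:
  assumes "F \<in> partial_gpartitions G X"
  shows "{f \<in> colourings G X q. dowling_le G F (colour_kernel f)} = spread G F ` (F \<rightarrow>\<^sub>E palette G q)"
  (is "?L = ?R")
proof
  show "?L \<subseteq> ?R"
    using colouring_is_spread[OF assms] by (simp add: subset_iff)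
  show "?R \<subseteq> ?L"
    using spread_in_colourings[OF assms] dowling_le_kernel_spread[OF assms] by (simp add: image_subset_iff)
qed

lemma inj_on_spread:
  assumes F: "F \<in> partial_gpartitions G X"
  shows "inj_on (spread G F) (F \<rightarrow>\<^sub>E palette G q)"
proof (rule inj_onI)
  fix \<phi> \<psi>
  assume \<phi>: "\<phi> \<in> F \<rightarrow>\<^sub>E palette G q" and \<psi>: "\<psi> \<in> F \<rightarrow>\<^sub>E palette G q"
    and eq: "spread G F \<phi> = spread G F \<psi>"
  show "\<phi> = \<psi>"
  proof (rule PiE_ext[OF \<phi> \<psi>])
    fix \<alpha> assume \<alpha>: "\<alpha> \<in> F"
    obtain x where x: "x \<in> dom \<alpha>"
      using block_nonempty[OF F \<alpha>] .
    have eqx: "map_option (\<lambda>(c, i). (c \<otimes> the (\<alpha> x), i)) (\<phi> \<alpha>)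
        = map_option (\<lambda>(c, i). (c \<otimes> the (\<alpha> x), i)) (\<psi> \<alpha>)"
      using spread_block[OF F \<alpha> x, of \<phi>] spread_block[OF F \<alpha> x, of \<psi>] eq by simp
    show "\<phi> \<alpha> = \<psi> \<alpha>"
    proof (cases "\<phi> \<alpha>")
      case None
      then show ?thesis using eqx by simp
    next
      case (Some a)
      then obtain c i where a: "\<phi> \<alpha> = Some (c, i)" by (cases a) auto
      then obtain d where b: "\<psi> \<alpha> = Some (d, i)" and cd: "c \<otimes> the (\<alpha> x) = d \<otimes> the (\<alpha> x)"
        using eqx by (auto simp: map_option_case split: option.splits)
      have "c = d"
        using cd palette_SomeD(1)[OF \<phi>, OF \<alpha> a] palette_SomeD(1)[OF \<psi>, OF \<alpha> b] block_value(2)[OF F \<alpha> x]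
        by simp
      then show ?thesis using a b by simp
    qed
  qed
qed

text \<open>
  The kernel always lies above \<open>F\<close>, so it can only fail to be equivalent to \<open>F\<close> by losing a block
  (coloured \<open>None\<close>) or by merging two blocks (coloured with the same index).
\<close>
lemma kernel_spread_le_iff:
  assumes F: "F \<in> partial_gpartitions G X" and \<phi>: "\<phi> \<in> F \<rightarrow>\<^sub>E palette G q"
  shows "dowling_le G (colour_kernel (spread G F \<phi>)) F \<longleftrightarrow>
    (\<forall>\<alpha>\<in>F. \<phi> \<alpha> \<noteq> None) \<and> inj_on (snd \<circ> the \<circ> \<phi>) F"
proof
  assume le: "dowling_le G (colour_kernel (spread G F \<phi>)) F"
  have key: "\<exists>c i. \<phi> \<alpha> = Some (c, i) \<and> dom (colour_block (spread G F \<phi>) i) \<subseteq> dom \<alpha>"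
    if \<alpha>: "\<alpha> \<in> F" for \<alpha>
  proof -
    obtain x where x: "x \<in> dom \<alpha>"
      using block_nonempty[OF F \<alpha>] .
    obtain M where M: "M \<subseteq> colour_kernel (spread G F \<phi>)" "dom \<alpha> = (\<Union>\<beta>\<in>M. dom \<beta>)"
      using bspec[OF le[unfolded dowling_le_def] \<alpha>] by (elim exE conjE) (rule that)
    obtain \<beta> where \<beta>: "\<beta> \<in> M" "x \<in> dom \<beta>"
      using x unfolding M(2) by blast
    have "\<beta> \<in> colour_kernel (spread G F \<phi>)"
      by (rule subsetD[OF M(1) \<beta>(1)])
    then obtain i where i: "\<beta> = colour_block (spread G F \<phi>) i"
      unfolding kernel_iff by (elim exE conjE)
    then obtain g where "spread G F \<phi> x = Some (g, i)"
      using \<beta>(2) by (auto simp: in_dom_colour_block)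
    then have "\<exists>c. \<phi> \<alpha> = Some (c, i)"
      using spread_block[OF F \<alpha> x] by auto
    moreover have "dom \<beta> \<subseteq> dom \<alpha>"
      unfolding M(2) using \<beta>(1) by blast
    ultimately show ?thesis
      using i by blast
  qed
  have "inj_on (snd \<circ> the \<circ> \<phi>) F"
  proof (rule inj_onI)
    fix \<alpha> \<beta> assume \<alpha>: "\<alpha> \<in> F" and \<beta>: "\<beta> \<in> F" and eq: "(snd \<circ> the \<circ> \<phi>) \<alpha> = (snd \<circ> the \<circ> \<phi>) \<beta>"
    obtain c i where c: "\<phi> \<alpha> = Some (c, i)" "dom (colour_block (spread G F \<phi>) i) \<subseteq> dom \<alpha>"
      using key[OF \<alpha>] by blast
    obtain d where d: "\<phi> \<beta> = Some (d, i)"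
      using key[OF \<beta>] eq c(1) by auto
    obtain x where x: "x \<in> dom \<beta>"
      using block_nonempty[OF F \<beta>] .
    have "x \<in> dom (colour_block (spread G F \<phi>) i)"
      using spread_block[OF F \<beta> x] d by (simp add: in_dom_colour_block)
    then show "\<alpha> = \<beta>"
      using block_unique[OF F \<alpha> \<beta>] c(2) x by blast
  qed
  then show "(\<forall>\<alpha>\<in>F. \<phi> \<alpha> \<noteq> None) \<and> inj_on (snd \<circ> the \<circ> \<phi>) F"
    using key by fastforce
next
  assume *: "(\<forall>\<alpha>\<in>F. \<phi> \<alpha> \<noteq> None) \<and> inj_on (snd \<circ> the \<circ> \<phi>) F"
  show "dowling_le G (colour_kernel (spread G F \<phi>)) F"
    unfolding dowling_le_def
  proof
    fix \<alpha> assume \<alpha>: "\<alpha> \<in> F"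
    obtain c i where c: "\<phi> \<alpha> = Some (c, i)"
      using * \<alpha> by fastforce
    have carr: "c \<in> carrier G"
      using palette_SomeD(1)[OF \<phi>, OF \<alpha> c] .
    let ?\<beta> = "colour_block (spread G F \<phi>) i"
    have val: "spread G F \<phi> x = Some (c \<otimes> the (\<alpha> x), i)" if "x \<in> dom \<alpha>" for x
      using spread_block[OF F \<alpha> that] c by simp
    have dom: "dom ?\<beta> = dom \<alpha>"
    proof
      show "dom \<alpha> \<subseteq> dom ?\<beta>"
        by (rule subsetI) (simp add: in_dom_colour_block val del: domIff)
      show "dom ?\<beta> \<subseteq> dom \<alpha>"
      proof
        fix x assume "x \<in> dom ?\<beta>"
        then obtain g where "spread G F \<phi> x = Some (g, i)"
          by (auto simp: in_dom_colour_block)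
        then obtain \<alpha>' d where d: "\<alpha>' \<in> F" "x \<in> dom \<alpha>'" "\<phi> \<alpha>' = Some (d, i)"
          by (elim spread_SomeE[OF F])
        have "\<alpha>' = \<alpha>"
          using * \<alpha> c d by (auto dest: inj_onD[of _ _ \<alpha>' \<alpha>])
        then show "x \<in> dom \<alpha>" using d(2) by simp
      qed
    qed
    obtain x where "x \<in> dom \<alpha>"
      using block_nonempty[OF F \<alpha>] .
    then have "?\<beta> \<in> colour_kernel (spread G F \<phi>)"
      unfolding kernel_iff using val by blast
    moreover have "the (\<alpha> x) = inv c \<otimes> the (?\<beta> x)" if "x \<in> dom ?\<beta>" for x
    proof -
      have x: "x \<in> dom \<alpha>"
        using that dom by simp
      then have "?\<beta> x = Some (c \<otimes> the (\<alpha> x))"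
        using val by simp
      then have "the (?\<beta> x) = c \<otimes> the (\<alpha> x)"
        by (simp only: option.sel)
      then show ?thesis
        using carr block_value(2)[OF F \<alpha> x] by (simp add: m_assoc[symmetric])
    qed
    ultimately show "\<exists>M\<subseteq>colour_kernel (spread G F \<phi>). dom \<alpha> = (\<Union>\<beta>\<in>M. dom \<beta>) \<and>
        (\<forall>\<beta>\<in>M. \<exists>c\<in>carrier G. \<forall>x\<in>dom \<beta>. the (\<alpha> x) = c \<otimes> the (\<beta> x))"
      using carr dom by (intro exI[of _ "{?\<beta>}"]) auto
  qed
qed

lemma card_palette:
  assumes "finite (carrier G)"
  shows "finite (palette G q)" "card (palette G q) = 1 + order G * q"
proof -
  show "finite (palette G q)"
    using assms by (simp add: palette_def)
  have "card (Some ` (carrier G \<times> {..<q})) = order G * q"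
    by (simp add: card_image card_cartesian_product order_def)
  then show "card (palette G q) = 1 + order G * q"
    unfolding palette_def using assms by (subst card_insert_disjoint) auto
qed

lemma card_colourings_above:
  assumes "finite X" "finite (carrier G)" and F: "F \<in> partial_gpartitions G X"
  shows "card {f \<in> colourings G X q. dowling_le G F (colour_kernel f)} = (1 + order G * q) ^ card F"
proof -
  have "finite F"
    using finite_partial_gpartition(1)[OF assms(1) F] .
  then show ?thesis
    unfolding colourings_above[OF F]
    by (simp add: card_image[OF inj_on_spread[OF F]] card_funcsetE card_palette[OF assms(2)])
qed

end

text \<open>
  The number of colourings whose kernel is in a prescribed class with \<open>k\<close> blocks. As in the theory of chromatic
  polynomials, with \<open>\<lambda> = 1 + m q\<close> colours it is the polynomial
  \<open>(\<lambda> - 1) (\<lambda> - 1 - m) \<dots> (\<lambda> - 1 - (k - 1) m)\<close>. The subtraction is one of integers, so that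
  the recurrence \<open>proper_count_Suc\<close> can be used without a case distinction.
\<close>
definition proper_count :: "nat \<Rightarrow> nat \<Rightarrow> nat \<Rightarrow> int" where
  "proper_count m k q = (\<Prod>i<k. int m * (int q - int i))"

lemma proper_count_Suc:
  "proper_count m (Suc k) q = proper_count m k q * (int m * (int q - int k))"
  by (simp add: proper_count_def)

lemma proper_count_eq_0:
  "q < k \<Longrightarrow> proper_count m k q = 0"
  by (auto simp: proper_count_def)

lemma proper_count_nonzero:
  "m > 0 \<Longrightarrow> k \<le> q \<Longrightarrow> proper_count m k q \<noteq> 0"
  by (auto simp: proper_count_def)

lemma prod_diff_eq_proper_count:
  "int (m ^ k * (\<Prod>i<k. q - i)) = proper_count m k q"
proof (cases "q < k")
  case True
  then have "(\<Prod>i<k. q - i) = 0"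
    by auto
  then show ?thesis
    using proper_count_eq_0[OF True] by simp
next
  case False
  then have "int (\<Prod>i<k. q - i) = (\<Prod>i<k. int q - int i)"
    unfolding of_nat_prod by (intro prod.cong) auto
  then show ?thesis
    by (simp add: proper_count_def prod.distrib)
qed

context group
begin

text \<open>
  Choosing colours different from \<open>None\<close> with distinct indices amounts to choosing an arbitrary map
  to \<open>G\<close> and, independently, an injective map to the indices.
\<close>
lemma card_proper_choices:
  assumes "finite F" "finite (carrier G)"
  shows "int (card {\<phi> \<in> F \<rightarrow>\<^sub>E palette G q.
      (\<forall>\<alpha>\<in>F. \<phi> \<alpha> \<noteq> None) \<and> inj_on (snd \<circ> the \<circ> \<phi>) F}) = proper_count (order G) (card F) q"
proof -
  let ?S = "{\<phi> \<in> F \<rightarrow>\<^sub>E palette G q. (\<forall>\<alpha>\<in>F. \<phi> \<alpha> \<noteq> None) \<and> inj_on (snd \<circ> the \<circ> \<phi>) F}"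
  let ?T = "(F \<rightarrow>\<^sub>E carrier G) \<times> {h \<in> F \<rightarrow>\<^sub>E {..<q}. inj_on h F}"
  have "bij_betw (\<lambda>\<phi>. (\<lambda>\<alpha>\<in>F. fst (the (\<phi> \<alpha>)), \<lambda>\<alpha>\<in>F. snd (the (\<phi> \<alpha>)))) ?S ?T"
  proof (rule bij_betw_byWitness[where f' = "\<lambda>(g, h). \<lambda>\<alpha>\<in>F. Some (g \<alpha>, h \<alpha>)"])
    show "\<forall>\<phi>\<in>?S. (\<lambda>(g, h). \<lambda>\<alpha>\<in>F. Some (g \<alpha>, h \<alpha>))
        (\<lambda>\<alpha>\<in>F. fst (the (\<phi> \<alpha>)), \<lambda>\<alpha>\<in>F. snd (the (\<phi> \<alpha>))) = \<phi>"
      by (fastforce simp: fun_eq_iff PiE_def extensional_def)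
    show "\<forall>p\<in>?T. (\<lambda>\<phi>. (\<lambda>\<alpha>\<in>F. fst (the (\<phi> \<alpha>)), \<lambda>\<alpha>\<in>F. snd (the (\<phi> \<alpha>))))
        ((\<lambda>(g, h). \<lambda>\<alpha>\<in>F. Some (g \<alpha>, h \<alpha>)) p) = p"
      by (auto simp: fun_eq_iff PiE_def extensional_def)
    show "(\<lambda>\<phi>. (\<lambda>\<alpha>\<in>F. fst (the (\<phi> \<alpha>)), \<lambda>\<alpha>\<in>F. snd (the (\<phi> \<alpha>)))) ` ?S \<subseteq> ?T"
    proof (intro image_subsetI)
      fix \<phi> assume \<phi>: "\<phi> \<in> ?S"
      have "fst (the (\<phi> \<alpha>)) \<in> carrier G \<and> snd (the (\<phi> \<alpha>)) < q" if "\<alpha> \<in> F" for \<alpha>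
      proof -
        have "\<phi> \<alpha> \<in> palette G q" "\<phi> \<alpha> \<noteq> None"
          using \<phi> that PiE_mem[of \<phi> F "\<lambda>_. palette G q" \<alpha>] by auto
        then show ?thesis
          by (auto simp: palette_def)
      qed
      moreover have "inj_on (\<lambda>\<alpha>\<in>F. snd (the (\<phi> \<alpha>))) F"
        using \<phi> by (simp add: comp_def)
      ultimately show "(\<lambda>\<alpha>\<in>F. fst (the (\<phi> \<alpha>)), \<lambda>\<alpha>\<in>F. snd (the (\<phi> \<alpha>))) \<in> ?T"
        by auto
    qed
    show "(\<lambda>(g, h). \<lambda>\<alpha>\<in>F. Some (g \<alpha>, h \<alpha>)) ` ?T \<subseteq> ?S"
    proof (intro image_subsetI)
      fix p assume p: "p \<in> ?T"
      obtain g h where gh: "p = (g, h)"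
        by (cases p)
      have g: "g \<in> F \<rightarrow>\<^sub>E carrier G" and h: "h \<in> F \<rightarrow>\<^sub>E {..<q}" "inj_on h F"
        using p gh by simp_all
      have "inj_on (snd \<circ> the \<circ> (\<lambda>\<alpha>\<in>F. Some (g \<alpha>, h \<alpha>))) F"
        using h(2) by (simp add: inj_on_def)
      moreover have "(\<lambda>\<alpha>\<in>F. Some (g \<alpha>, h \<alpha>)) \<in> F \<rightarrow>\<^sub>E palette G q"
        unfolding palette_def using PiE_mem[OF g] PiE_mem[OF h(1)] by auto
      ultimately show "(\<lambda>(g, h). \<lambda>\<alpha>\<in>F. Some (g \<alpha>, h \<alpha>)) p \<in> ?S"
        by (simp add: gh)
    qed
  qed
  then have "card ?S = card ?T"
    by (rule bij_betw_same_card)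
  also have "\<dots> = order G ^ card F * (\<Prod>i<card F. q - i)"
    using card_inj_on_subset_funcset[OF assms(1) finite_lessThan[of q] order_refl]
    by (simp add: card_cartesian_product card_funcsetE[OF assms(1)] order_def atLeast0LessThan)
  finally show ?thesis
    by (simp only: prod_diff_eq_proper_count)
qed

lemma card_colourings_equiv:
  assumes "finite X" "finite (carrier G)" and F: "F \<in> partial_gpartitions G X"
  shows "int (card {f \<in> colourings G X q. dowling_le G F (colour_kernel f) \<and> dowling_le G (colour_kernel f) F})
    = proper_count (order G) (card F) q"
proof -
  let ?S = "{\<phi> \<in> F \<rightarrow>\<^sub>E palette G q. (\<forall>\<alpha>\<in>F. \<phi> \<alpha> \<noteq> None) \<and> inj_on (snd \<circ> the \<circ> \<phi>) F}"
  have "{f \<in> colourings G X q. dowling_le G F (colour_kernel f) \<and> dowling_le G (colour_kernel f) F}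
      = {f \<in> {f \<in> colourings G X q. dowling_le G F (colour_kernel f)}. dowling_le G (colour_kernel f) F}"
    by (simp only: mem_Collect_eq conj_assoc)
  also have "\<dots> = {f \<in> spread G F ` (F \<rightarrow>\<^sub>E palette G q). dowling_le G (colour_kernel f) F}"
    by (simp only: colourings_above[OF F])
  also have "\<dots> = spread G F ` {\<phi> \<in> F \<rightarrow>\<^sub>E palette G q. dowling_le G (colour_kernel (spread G F \<phi>)) F}"
    by (rule Compr_image_eq)
  also have "\<dots> = spread G F ` ?S"
    using kernel_spread_le_iff[OF F] by (intro arg_cong[where f = "(`) (spread G F)"] Collect_cong) auto
  finally have eq: "{f \<in> colourings G X q. dowling_le G F (colour_kernel f) \<and> dowling_le G (colour_kernel f) F}
      = spread G F ` ?S" .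
  have "inj_on (spread G F) ?S"
    by (rule inj_on_subset[OF inj_on_spread[OF F]]) (rule Collect_restrict)
  then show ?thesis
    unfolding eq
    by (simp only: card_image card_proper_choices[OF finite_partial_gpartition(1)[OF assms(1) F] assms(2)])
qed

end

section \<open>Whitney numbers and the colour count\<close>

text \<open>
  The number of blocks is invariant under the equivalence, so it is the same for all members of a
  class. It is obtained here from the rank, which the Whitney numbers refer to.
\<close>
definition block_number :: "'a set \<Rightarrow> ('a \<rightharpoonup> 'g) set set \<Rightarrow> nat" where
  "block_number X C = nat (int (card X) - dowling_rank X C)"

context group
begin

lemma finite_colourings:
  assumes "finite X" "finite (carrier G)"
  shows "finite (colourings G X q :: ('c \<rightharpoonup> 'a \<times> nat) set)"
proof -
  have "colourings G X q \<subseteq>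
      (\<Union>A\<in>Pow X. {f :: 'c \<rightharpoonup> 'a \<times> nat. dom f = A \<and> ran f \<subseteq> carrier G \<times> {..<q}})"
    by (auto simp: colourings_def)
  moreover have "finite (\<Union>A\<in>Pow X. {f :: 'c \<rightharpoonup> 'a \<times> nat. dom f = A \<and> ran f \<subseteq> carrier G \<times> {..<q}})"
    using assms by (auto intro!: finite_set_of_finite_maps intro: finite_subset)
  ultimately show ?thesis
    by (rule finite_subset)
qed

lemma block_number_eq:
  assumes "finite X" "C \<in> carrier (dowling_lattice G X)" "F \<in> C"
  shows "block_number X C = card F"
  using dowling_rank_eq[OF assms] by (simp add: block_number_def)

lemma dowling_carrierE:
  assumes "C \<in> carrier (dowling_lattice G X)"
  obtains F where "F \<in> C" "F \<in> partial_gpartitions G X" "C = dowling_equiv G X `` {F}"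
proof -
  have "C \<in> partial_gpartitions G X // dowling_equiv G X"
    using assms by (simp add: dowling_lattice_def)
  then obtain F where "F \<in> partial_gpartitions G X" "C = dowling_equiv G X `` {F}"
    by (rule quotientE)
  then show ?thesis
    using that equiv_class_self[OF equiv_dowling_equiv] by blast
qed

lemma dowling_lattice_le_class:
  assumes F: "F \<in> partial_gpartitions G X" and H: "H \<in> partial_gpartitions G X"
  shows "dowling_equiv G X `` {F} \<sqsubseteq>\<^bsub>dowling_lattice G X\<^esub> dowling_equiv G X `` {H} \<longleftrightarrow>
    dowling_le G F H"
proof
  assume "dowling_equiv G X `` {F} \<sqsubseteq>\<^bsub>dowling_lattice G X\<^esub> dowling_equiv G X `` {H}"
  then obtain F' H' where "(F, F') \<in> dowling_equiv G X" "(H, H') \<in> dowling_equiv G X"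
      "dowling_le G F' H'"
    by (auto simp: dowling_lattice_def)
  then have "F' \<in> partial_gpartitions G X" "dowling_le G F F'" "dowling_le G F' H'" "dowling_le G H' H"
    by (auto simp: dowling_equiv_def)
  then show "dowling_le G F H"
    using dowling_le_trans F by meson
next
  assume "dowling_le G F H"
  then show "dowling_equiv G X `` {F} \<sqsubseteq>\<^bsub>dowling_lattice G X\<^esub> dowling_equiv G X `` {H}"
    using equiv_class_self[OF equiv_dowling_equiv] F H by (auto simp: dowling_lattice_def)
qed

text \<open>
  Both sides count the colourings whose kernel lies above a representative of \<open>C\<close>, the left-hand
  side according to the class of the kernel.
\<close>
lemma sum_proper_count_above:
  assumes fin: "finite X" "finite (carrier G)" and C: "C \<in> carrier (dowling_lattice G X)"
  shows "(\<Sum>D\<in>{D \<in> carrier (dowling_lattice G X). C \<sqsubseteq>\<^bsub>dowling_lattice G X\<^esub> D}.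
      proper_count (order G) (block_number X D) q) = (1 + int (order G) * int q) ^ block_number X C"
proof -
  let ?L = "dowling_lattice G X"
  let ?T = "{D \<in> carrier ?L. C \<sqsubseteq>\<^bsub>?L\<^esub> D}"
  let ?c = "\<lambda>f. dowling_equiv G X `` {colour_kernel f}"
  obtain F where F: "F \<in> C" "F \<in> partial_gpartitions G X" "C = dowling_equiv G X `` {F}"
    using dowling_carrierE[OF C] .
  let ?S = "{f \<in> colourings G X q. dowling_le G F (colour_kernel f)}"
  note ker = kernel_in_partial_gpartitions[of _ G X q]
  have "finite ?S"
    using finite_colourings[OF fin] by simp
  moreover have "finite ?T"
    using finite_dowling_lattice[OF fin] by simp
  moreover have "?c f \<in> ?T" if "f \<in> ?S" for f
    using that ker dowling_lattice_le_class[OF F(2)] unfolding F(3)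
    by (simp add: dowling_lattice_def quotientI)
  then have "?c ` ?S \<subseteq> ?T"
    by (rule image_subsetI)
  ultimately have "(\<Sum>D\<in>?T. \<Sum>f\<in>{f \<in> ?S. ?c f = D}. (1::int)) = (\<Sum>f\<in>?S. 1)"
    by (rule sum.group)
  moreover have "(\<Sum>f\<in>{f \<in> ?S. ?c f = D}. (1::int)) = proper_count (order G) (block_number X D) q"
    if D: "D \<in> ?T" for D
  proof -
    obtain H where H: "H \<in> D" "H \<in> partial_gpartitions G X" "D = dowling_equiv G X `` {H}"
      using dowling_carrierE D by blast
    have FH: "dowling_le G F H"
      using D dowling_lattice_le_class[OF F(2) H(2)] F(3) H(3) by simp
    have "f \<in> ?S \<and> ?c f = D \<longleftrightarrow>
        f \<in> colourings G X q \<and> dowling_le G H (colour_kernel f) \<and> dowling_le G (colour_kernel f) H" for f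
    proof -
      have "?c f = D \<longleftrightarrow> dowling_le G H (colour_kernel f) \<and> dowling_le G (colour_kernel f) H"
        if f: "f \<in> colourings G X q"
        using eq_equiv_class_iff[OF equiv_dowling_equiv ker[OF f] H(2)] ker[OF f] H(2)
        unfolding H(3) by (auto simp: dowling_equiv_def)
      moreover have "dowling_le G F (colour_kernel f)" if "dowling_le G H (colour_kernel f)"
        using dowling_le_trans[OF F(2) FH that] .
      ultimately show ?thesis
        by auto
    qed
    then have "{f \<in> ?S. ?c f = D} = {f \<in> colourings G X q. dowling_le G H (colour_kernel f) \<and>
        dowling_le G (colour_kernel f) H}"
      by (intro Collect_cong) simp
    then have "(\<Sum>f\<in>{f \<in> ?S. ?c f = D}. (1::int)) = proper_count (order G) (card H) q"
      using card_colourings_equiv[OF fin H(2), of q] by simp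
    also have "card H = block_number X D"
      using block_number_eq[OF fin(1) _ H(1)] D by simp
    finally show ?thesis .
  qed
  ultimately have "(\<Sum>D\<in>?T. proper_count (order G) (block_number X D) q) = int (card ?S)"
    by simp
  then show ?thesis
    using card_colourings_above[OF fin F(2), of q] block_number_eq[OF fin(1) C F(1)] by simp
qed

lemma block_number_dowling_zero:
  assumes "finite X"
  shows "block_number X (dowling_zero G X) = card X"
proof -
  let ?E = "(\<lambda>x. [x \<mapsto> \<one>]) ` X"
  have "?E \<in> partial_gpartitions G X"
    by (auto simp: partial_gpartitions_def pairwise_def disjnt_iff split: if_splits)
  then have mem: "?E \<in> dowling_zero G X"
    using equiv_class_self[OF equiv_dowling_equiv] by (simp add: dowling_zero_def)
  have "dowling_zero G X \<in> carrier (dowling_lattice G X)"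
    using least_dowling_zero[of X] by (simp add: least_def)
  then have "block_number X (dowling_zero G X) = card ?E"
    using block_number_eq[OF assms _ mem] by simp
  also have "\<dots> = card X"
  proof (rule card_image, rule inj_onI)
    show "x = y" if "[x \<mapsto> \<one>] = [y \<mapsto> \<one>]" for x y :: 'c
      using arg_cong[OF that, of dom] by simp
  qed
  finally show ?thesis .
qed

lemma sum_by_block_number:
  fixes h :: "(nat \<rightharpoonup> 'a) set set \<Rightarrow> int"
  assumes "finite (carrier G)"
  shows "(\<Sum>C\<in>carrier (dowling_lattice G {1..n}). h C * p (block_number {1..n} C))
    = (\<Sum>k\<le>n. (\<Sum>C\<in>{C \<in> carrier (dowling_lattice G {1..n}).
        dowling_rank {1..n} C = int n - int k}. h C) * p k)"
proof -
  let ?X = "{1..n::nat}"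
  let ?L = "carrier (dowling_lattice G ?X)"
  have rank: "dowling_rank ?X C = int n - int (block_number ?X C) \<and> block_number ?X C \<le> n"
    if C: "C \<in> ?L" for C
  proof -
    obtain F where F: "F \<in> C" "F \<in> partial_gpartitions G ?X"
      using dowling_carrierE[OF C] by blast
    show ?thesis
      using dowling_rank_eq[OF _ C F(1)] block_number_eq[OF _ C F(1)]
        finite_partial_gpartition(2)[OF _ F(2)] by simp
  qed
  have "(\<Sum>C\<in>?L. h C * p (block_number ?X C))
      = (\<Sum>k\<le>n. \<Sum>C\<in>{C \<in> ?L. block_number ?X C = k}. h C * p (block_number ?X C))"
    using finite_dowling_lattice[of ?X] assms rank by (intro sum.group[symmetric]) auto
  also have "\<dots> = (\<Sum>k\<le>n. (\<Sum>C\<in>{C \<in> ?L. dowling_rank ?X C = int n - int k}. h C) * p k)"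
  proof (rule sum.cong[OF refl])
    fix k
    have "{C \<in> ?L. block_number ?X C = k} = {C \<in> ?L. dowling_rank ?X C = int n - int k}"
      using rank by auto
    moreover have "(\<Sum>C\<in>{C \<in> ?L. block_number ?X C = k}. h C * p (block_number ?X C))
        = (\<Sum>C\<in>{C \<in> ?L. block_number ?X C = k}. h C * p k)"
      by (intro sum.cong) auto
    ultimately show "(\<Sum>C\<in>{C \<in> ?L. block_number ?X C = k}. h C * p (block_number ?X C))
        = (\<Sum>C\<in>{C \<in> ?L. dowling_rank ?X C = int n - int k}. h C) * p k"
      by (simp add: sum_distrib_right)
  qed
  finally show ?thesis .
qed

text \<open>
  This is the count of all colourings, which are the ones above the least element. The upper
  limit \<open>N\<close> is arbitrary, so that expansions for different \<open>n\<close> can be added up term by term.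
\<close>
lemma sum_whitney2:
  assumes "finite (carrier G)" "n \<le> N"
  shows "(\<Sum>t\<le>N. whitney2 G n t * proper_count (order G) t q) = (1 + int (order G) * int q) ^ n"
proof -
  let ?X = "{1..n::nat}"
  let ?L = "dowling_lattice G ?X"
  have zero: "dowling_zero G ?X \<in> carrier ?L"
      "\<And>D. D \<in> carrier ?L \<Longrightarrow> dowling_zero G ?X \<sqsubseteq>\<^bsub>?L\<^esub> D"
    using least_dowling_zero[of ?X] by (auto simp: least_def)
  have "(\<Sum>t\<le>N. whitney2 G n t * proper_count (order G) t q)
      = (\<Sum>t\<le>n. whitney2 G n t * proper_count (order G) t q)"
    using assms(2) whitney_eq_0(2) by (intro sum.mono_neutral_right) auto
  also have "\<dots> = (\<Sum>D\<in>carrier ?L. 1 * proper_count (order G) (block_number ?X D) q)"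
    unfolding whitney2_def
    by (rule sum_by_block_number[OF assms(1), where h = "\<lambda>_. 1" and p = "\<lambda>t. proper_count (order G) t q", symmetric])
  also have "\<dots> = (\<Sum>D\<in>{D \<in> carrier ?L. dowling_zero G ?X \<sqsubseteq>\<^bsub>?L\<^esub> D}.
      proper_count (order G) (block_number ?X D) q)"
    using zero(2) by (intro sum.cong) auto
  also have "\<dots> = (1 + int (order G) * int q) ^ n"
    using sum_proper_count_above[OF _ assms(1) zero(1)] block_number_dowling_zero[of ?X] by simp
  finally show ?thesis .
qed

text \<open>
  By Moebius inversion, the sum counts the colourings whose kernel is equivalent to the partition
  into singletons. In other words, the characteristic polynomial of the Dowling lattice has the
  roots \<open>1, 1 + m, \<dots>, 1 + (n - 1) m\<close>.
\<close>
lemma sum_whitney1: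
  assumes "finite (carrier G)"
  shows "(\<Sum>k\<le>n. whitney1 G n k * (1 + int (order G) * int q) ^ k) = proper_count (order G) n q"
proof -
  let ?X = "{1..n::nat}"
  let ?L = "dowling_lattice G ?X"
  have "(\<Sum>k\<le>n. whitney1 G n k * (1 + int (order G) * int q) ^ k)
      = (\<Sum>C\<in>carrier ?L. mobius ?L (dowling_zero G ?X) C *
          (1 + int (order G) * int q) ^ block_number ?X C)"
    unfolding whitney1_def
    by (rule sum_by_block_number[OF assms, where h = "mobius ?L (dowling_zero G ?X)"
          and p = "\<lambda>k. (1 + int (order G) * int q) ^ k", symmetric])
  also have "\<dots> = proper_count (order G) (block_number ?X (dowling_zero G ?X)) q"
    using sum_proper_count_above[OF _ assms, of ?X _ q]
    by (intro mobius_inversion_at_least[OF partial_order_dowling_lattice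
          finite_dowling_lattice[OF _ assms] least_dowling_zero]) simp_all
  finally show ?thesis
    by (simp add: block_number_dowling_zero)
qed

end

section \<open>The shifted convolution\<close>

text \<open>
  The matrix of the values \<open>proper_count m t q\<close> is triangular with non-zero diagonal, so the
  coefficients can be solved for one after another, taking \<open>q = t\<close>.
\<close>
lemma proper_count_coeffs_unique:
  fixes a b :: "nat \<Rightarrow> int"
  assumes m: "m > 0"
    and eq: "\<And>q. (\<Sum>t\<le>N. a t * proper_count m t q) = (\<Sum>t\<le>N. b t * proper_count m t q)"
    and "t \<le> N"
  shows "a t = b t"
  using \<open>t \<le> N\<close>
proof (induction t rule: less_induct)
  case (less t)
  have "0 = (\<Sum>u\<le>N. (a u - b u) * proper_count m u t)"
    using eq[of t] by (simp add: left_diff_distrib sum_subtractf)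
  also have "\<dots> = (\<Sum>u\<in>{t}. (a u - b u) * proper_count m u t)"
  proof (rule sum.mono_neutral_right)
    show "\<forall>u\<in>{..N} - {t}. (a u - b u) * proper_count m u t = 0"
    proof
      fix u assume "u \<in> {..N} - {t}"
      then have "a u = b u \<or> t < u"
        using less.IH[of u] by auto
      then show "(a u - b u) * proper_count m u t = 0"
        by (auto simp: proper_count_eq_0)
    qed
  qed (use less.prems in auto)
  finally show ?case
    using proper_count_nonzero[OF m order_refl, of t] by simp
qed

context group
begin

text \<open>
  The Whitney numbers of the second kind expand the powers of \<open>1 + m q\<close> in the proper counts, and
  those of the first kind expand the proper counts in these powers. The shift by \<open>s\<close> between the
  two expansions contributes the factor \<open>(1 + m q) ^ s\<close>.
\<close>
lemma shifted_convolution_expansion: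
  assumes "finite (carrier G)" "n + s \<le> N"
  shows "(\<Sum>t\<le>N. shifted_convolution G n t s * proper_count (order G) t q)
    = proper_count (order G) n q * (1 + int (order G) * int q) ^ s"
proof -
  have "(\<Sum>t\<le>N. shifted_convolution G n t s * proper_count (order G) t q)
      = (\<Sum>t\<le>N. \<Sum>k\<le>n. whitney1 G n k * (whitney2 G (k + s) t * proper_count (order G) t q))"
    by (simp add: shifted_convolution_eq_sum sum_distrib_right mult.assoc)
  also have "\<dots> = (\<Sum>k\<le>n. whitney1 G n k * (\<Sum>t\<le>N. whitney2 G (k + s) t * proper_count (order G) t q))"
    by (subst sum.swap) (simp add: sum_distrib_left)
  also have "\<dots> = (\<Sum>k\<le>n. whitney1 G n k * (1 + int (order G) * int q) ^ (k + s))"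
    using assms by (intro sum.cong) (simp_all add: sum_whitney2)
  also have "\<dots> = (\<Sum>k\<le>n. whitney1 G n k * (1 + int (order G) * int q) ^ k) * (1 + int (order G) * int q) ^ s"
    by (simp add: sum_distrib_right power_add mult.assoc)
  finally show ?thesis
    by (simp add: sum_whitney1[OF assms(1)])
qed

lemma shifted_convolution_0:
  assumes "finite (carrier G)"
  shows "shifted_convolution G n t 0 = (if n = t then 1 else 0)"
proof (rule proper_count_coeffs_unique[where N = "max n t" and t = t])
  show "order G > 0"
    using assms by (simp add: order_gt_0_iff_finite)
  show "(\<Sum>t\<le>max n t. shifted_convolution G n t 0 * proper_count (order G) t q)
      = (\<Sum>t\<le>max n t. (if n = t then 1 else 0) * proper_count (order G) t q)" for q
    by (subst shifted_convolution_expansion[OF assms])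
      (simp_all add: if_distrib[where f = "\<lambda>c. c * _"] cong: if_cong)
qed simp

text \<open>
  Increasing \<open>s\<close> by one multiplies the expansion by \<open>1 + m q\<close>, and this factor acts on the proper
  counts by \<open>(1 + m q) p t q = p (t + 1) q + (1 + t m) p t q\<close>.
\<close>
lemma shifted_convolution_Suc:
  assumes "finite (carrier G)"
  shows "shifted_convolution G n t (Suc s) =
    (if t = 0 then 0 else shifted_convolution G n (t - 1) s) +
    (1 + int t * int (order G)) * shifted_convolution G n t s"
proof (rule proper_count_coeffs_unique[where N = "Suc (n + s + t)" and t = t])
  let ?p = "proper_count (order G)" and ?c = "\<lambda>t. shifted_convolution G n t s"
  let ?N = "n + s + t"
  show "order G > 0"
    using assms by (simp add: order_gt_0_iff_finite)
  fix q
  \<comment> \<open>The top coefficient must vanish, since the shift \<open>t \<mapsto> t + 1\<close> would leave the range of summation.\<close>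
  have "?c (Suc ?N) = 0"
    by (simp add: shifted_convolution_eq_sum whitney_eq_0(2))
  then have "(\<Sum>t\<le>Suc ?N. ((if t = 0 then 0 else ?c (t - 1)) + (1 + int t * int (order G)) * ?c t) * ?p t q)
      = (\<Sum>t\<le>?N. ?c t * ?p (Suc t) q) + (\<Sum>t\<le>?N. (1 + int t * int (order G)) * ?c t * ?p t q)"
    by (simp add: distrib_right sum.distrib sum.atMost_Suc_shift[of "\<lambda>t. (if t = 0 then 0 else ?c (t - 1)) * ?p t q"] del: sum.atMost_Suc)
       simp
  also have "\<dots> = (\<Sum>t\<le>?N. ?c t * ?p t q) * (1 + int (order G) * int q)"
    unfolding sum.distrib[symmetric] sum_distrib_right
    by (intro sum.cong refl) (simp add: proper_count_Suc algebra_simps)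
  also have "\<dots> = ?p n q * (1 + int (order G) * int q) ^ Suc s"
    by (subst shifted_convolution_expansion[OF assms]) (simp_all add: mult.assoc mult.commute)
  also have "\<dots> = (\<Sum>t\<le>Suc ?N. shifted_convolution G n t (Suc s) * ?p t q)"
    by (subst shifted_convolution_expansion[OF assms]) simp_all
  finally show "(\<Sum>t\<le>Suc ?N. shifted_convolution G n t (Suc s) * ?p t q) =
      (\<Sum>t\<le>Suc ?N. ((if t = 0 then 0 else ?c (t - 1)) + (1 + int t * int (order G)) * ?c t) * ?p t q)"
    by simp
qed simp

lemma shifted_convolution_eq_0:
  assumes "finite (carrier G)" "t < n"
  shows "shifted_convolution G n t s = 0"
  using assms(2)
  by (induction s arbitrary: t)
    (simp_all add: shifted_convolution_0[OF assms(1)] shifted_convolution_Suc[OF assms(1)])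

lemma shifted_convolution_fps:
  assumes "finite (carrier G)" "n \<le> t"
  shows "Abs_fps (\<lambda>s. rat_of_int (shifted_convolution G n t s)) * fps_X
    = (\<Prod>j=n..t. fps_X / (1 - fps_const (1 + of_nat j * of_nat (order G)) * fps_X))"
  using assms(2)
proof (induction t rule: dec_induct)
  let ?A = "\<lambda>t. Abs_fps (\<lambda>s. rat_of_int (shifted_convolution G n t s))"
  let ?d = "\<lambda>j. 1 - fps_const (1 + of_nat j * of_nat (order G) :: rat) * fps_X"
  \<comment> \<open>The initial value and the recurrence in \<open>s\<close>, expressed with generating functions.\<close>
  have shift: "?A t * ?d t = (if t = 0 then 0 else ?A (t - 1)) * fps_X + (if n = t then 1 else 0)" for t
  proof (rule fps_ext)
    fix s
    show "fps_nth (?A t * ?d t) s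
        = fps_nth ((if t = 0 then 0 else ?A (t - 1)) * fps_X + (if n = t then 1 else 0)) s"
      by (cases s) (auto simp: right_diff_distrib mult.assoc[symmetric] mult.commute[of _ "fps_const _"]
          shifted_convolution_0[OF assms(1)] shifted_convolution_Suc[OF assms(1)])
  qed
  have div: "fps_X / ?d j * ?d j = fps_X" for j
    by (rule dvd_div_mult_self, rule unit_imp_dvd) simp
  have nz: "?d j \<noteq> 0" for j
    by (metis (lifting) div fps_X_neq_zero mult_zero_right)
  have cancel: "A * fps_X = B * (fps_X / ?d j)" if "A * ?d j = B" for A B j
  proof -
    have "A * fps_X * ?d j = A * ?d j * fps_X"
      by (simp only: mult_ac)
    also have "\<dots> = B * (fps_X / ?d j) * ?d j"
      by (simp only: that mult.assoc div)
    finally show ?thesis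
      using nz[of j] by (simp only: mult_cancel_right simp_thms)
  qed
  {
    case base
    have "?A (n - 1) = 0" if "n \<noteq> 0"
      using that by (intro fps_ext) (simp add: shifted_convolution_eq_0[OF assms(1)])
    then have "?A n * ?d n = 1"
      by (subst shift) auto
    from cancel[OF this] show ?case
      by simp
  next
    case (step t)
    have "?A (Suc t) * ?d (Suc t) = ?A t * fps_X"
      using step.hyps by (subst shift) simp
    from cancel[OF this] show ?case
      using step by (simp add: prod.nat_ivl_Suc')
  }
qed

end

theorem proposition4:
  fixes G :: "('g, 'b) monoid_scheme" and m n :: nat
  assumes "group G" and "finite (carrier G)" and "order G = m" and "n > 0"
  shows "(\<forall>t s. t < n \<longrightarrow> shifted_convolution G n t s = 0)
       \<and> (\<forall>t\<ge>n. Abs_fps (\<lambda>s. rat_of_int (shifted_convolution G n t s))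
                = (\<Prod>j=n..t. fps_X / (1 - fps_const (1 + of_nat j * of_nat m) * fps_X)) / fps_X)
       \<and> (\<forall>t. Sum_any (\<lambda>k. whitney1 G n k * whitney2 G k t) = (if n = t then 1 else 0))"
proof (intro conjI allI impI)
  interpret group G by fact
  note fin = assms(2)
  show "shifted_convolution G n t s = 0" if "t < n" for t s
    using shifted_convolution_eq_0[OF fin that] .
  show "Abs_fps (\<lambda>s. rat_of_int (shifted_convolution G n t s))
      = (\<Prod>j=n..t. fps_X / (1 - fps_const (1 + of_nat j * of_nat m) * fps_X)) / fps_X"
    if "n \<le> t" for t
    unfolding shifted_convolution_fps[OF fin that, unfolded assms(3), symmetric]
    by (rule nonzero_mult_div_cancel_right[OF fps_X_neq_zero, symmetric])
  show "Sum_any (\<lambda>k. whitney1 G n k * whitney2 G k t) = (if n = t then 1 else 0)" for t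
    using shifted_convolution_0[OF fin, of n t] by (simp add: shifted_convolution_def)
qed

end
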